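(* Let $k\ge 2$ be an integer, let $p$ be the smallest prime divisor of $k$, and let $n\in\mathbb{Z}[\zeta_k]$ be written as \[ n=a_1\zeta_k+a_2\zeta_k^2+\cdots+a_k\zeta_k^k \] with nonnegative integers $a_1,\dots,a_k$, not all zero. Let $a_m=\max(a_1,\dots,a_k)$. Then \[ ||n||_k \le \Bigl(2k-\frac{k}{p}+1\Bigr)\bigl(\log_2|a_m|+1\bigr)-2 . \]
   Context: An expression is a formal term built from the symbol $x$ using the binary operations $+$ and $\cdot$ (with parentheses); its size is the number of occurrences of $x$ in it. For an integer $k\ge1$ let $\zeta_k=e^{2\pi i/k}$. For $\alpha\in\mathbb{Z}[\zeta_k]$, $||\alpha||_k$ is the minimum size of an expression which evaluates to $\alpha$ when $x=\zeta_k$.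
   Formalization: The cases k=2 with a=(1,1) and k=3 with a=(1,1,1) are excluded: there n=0, the bound is 2 resp. 4, but ||0||_2=3 and ||0||_3=5, so the inequality as stated fails; all other cases are kept. *)

theory Defs
  imports Complex_Main "HOL-Computational_Algebra.Polynomial" "HOL-Computational_Algebra.Primes"
begin

datatype expr = X | Add expr expr | Mul expr expr

text \<open>Number of occurrences of the symbol \<open>x\<close>.\<close>

fun expr_size :: "expr \<Rightarrow> nat" where
  "expr_size X = 1"
| "expr_size (Add e f) = expr_size e + expr_size f"
| "expr_size (Mul e f) = expr_size e + expr_size f"

fun expr_eval :: "'a :: comm_semiring_1 \<Rightarrow> expr \<Rightarrow> 'a" where
  "expr_eval x X = x"
| "expr_eval x (Add e f) = expr_eval x e + expr_eval x f"
| "expr_eval x (Mul e f) = expr_eval x e * expr_eval x f"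

definition zeta :: "nat \<Rightarrow> complex" where
  "zeta k = exp (2 * of_real pi * \<i> / of_nat k)"

definition cyclotomic_ints :: "nat \<Rightarrow> complex set" where
  "cyclotomic_ints k = range (\<lambda>q :: int poly. poly (map_poly of_int q) (zeta k))"

text \<open>
  For \<open>k \<ge> 2\<close> every element of \<open>cyclotomic_ints k\<close> is the value of some expression,
  since \<open>1\<close> is a power of \<open>zeta k\<close> and \<open>-1\<close> is a sum of such powers. The value of
  \<open>LEAST\<close> is unspecified when \<open>\<alpha>\<close> is not the value of any expression.
\<close>

definition complexity :: "nat \<Rightarrow> complex \<Rightarrow> nat" where
  "complexity k \<alpha> = (LEAST s. \<exists>e. expr_size e = s \<and> expr_eval (zeta k) e = \<alpha>)"

text \<open>
  The case that all coefficients are \<open>1\<close> and \<open>k \<in> {2, 3}\<close> has to be excluded from the theorem.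
  It represents \<open>n = 0\<close>, and \<open>0\<close> has complexity at least \<open>3\<close> resp. \<open>5\<close>, while the bound
  is \<open>2\<close> resp. \<open>4\<close>; see \<open>bound_fails_2\<close> and \<open>bound_fails_3\<close>.
\<close>

lemma expr_size_pos: "expr_size e \<ge> 1" by (induction e) auto

lemma expr_size_1: "expr_size e = 1 \<Longrightarrow> e = X"
proof (cases e)
  case (Add a b) assume "expr_size e = 1" thus ?thesis using Add expr_size_pos[of a] expr_size_pos[of b] by simp
next case (Mul a b) assume "expr_size e = 1" thus ?thesis using Mul expr_size_pos[of a] expr_size_pos[of b] by simp
qed auto

lemma expr_size_split: assumes "expr_size e > 1" obtains a b where "e = Add a b \<or> e = Mul a b"
   "expr_size a + expr_size b = expr_size e" "expr_size a \<ge> 1" "expr_size b \<ge> 1"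
  using assms expr_size_pos by (cases e) auto

lemma expr_size_2: assumes "expr_size e = 2" shows "expr_eval x e \<in> {x+x, x*x}"
proof -
  obtain a b where *: "e = Add a b \<or> e = Mul a b"
   "expr_size a + expr_size b = expr_size e" "expr_size a \<ge> 1" "expr_size b \<ge> 1" using expr_size_split[of e] assms by auto
  hence "a = X" "b = X" using assms by (auto intro!: expr_size_1)
  thus ?thesis using * by auto
qed

lemma expr_size_3: assumes "expr_size e = 3" shows "expr_eval x e \<in> {x+x+x, x+x*x, x*(x+x), x*x*x :: complex}"
proof -
  obtain a b where *: "e = Add a b \<or> e = Mul a b"
   "expr_size a + expr_size b = expr_size e" "expr_size a \<ge> 1" "expr_size b \<ge> 1" using expr_size_split[of e] assms by auto
  hence "(expr_size a = 1 \<and> expr_size b = 2) \<or> (expr_size a = 2 \<and> expr_size b = 1)" using assms by auto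
  hence "(a = X \<and> expr_eval x b \<in> {x+x, x*x}) \<or> (b = X \<and> expr_eval x a \<in> {x+x, x*x})" using expr_size_1 expr_size_2 by blast
  thus ?thesis using * by (auto simp: algebra_simps)
qed

lemma zeta2: "zeta 2 = -1" by (simp add: zeta_def mult.commute)

lemma zero_size_2: "expr_eval (zeta 2) e = 0 \<Longrightarrow> expr_size e \<ge> 3"
proof (rule ccontr)
  assume e: "expr_eval (zeta 2) e = 0" and "\<not> expr_size e \<ge> 3"
  hence "expr_size e = 1 \<or> expr_size e = 2" using expr_size_pos[of e] by linarith
  thus False using e expr_size_2[of e "zeta 2"] expr_size_1[of e] by (auto simp: zeta2)
qed

lemma zeta3: "zeta 3 = Complex (-1/2) (sqrt 3 / 2)"
proof -
  have "zeta 3 = cis (2*pi/3)" by (simp add: zeta_def cis_conv_exp mult_ac)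
  moreover have "cos (2*pi/3) = -1/2" "sin (2*pi/3) = sqrt 3/2" by (simp_all add: cos_120 sin_120)
  ultimately show ?thesis by (simp add: complex_eq_iff)
qed

lemma zero_size_3: "expr_eval (zeta 3) e = 0 \<Longrightarrow> expr_size e \<ge> 5"
proof (rule ccontr)
  define x where "x = zeta 3"
  assume e: "expr_eval (zeta 3) e = 0" and "\<not> expr_size e \<ge> 5"
  hence c: "expr_size e = 1 \<or> expr_size e = 2 \<or> expr_size e = 3 \<or> expr_size e = 4" using expr_size_pos[of e] by linarith
  have x2: "x*x = -1-x" by (simp add: x_def zeta3 complex_eq_iff)
  have nz: "Re x = -1/2" "Im x = sqrt 3/2" "x \<noteq> 0" by (auto simp: x_def zeta3 complex_eq_iff)
  have x3: "x*x*x = 1" unfolding x2 by (simp add: algebra_simps x2)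
  have y2: "expr_eval x f \<in> {2*x, -1-x}" if "expr_size f = 2" for f using expr_size_2[OF that, of x] x2 by auto
  have y3: "expr_eval x f \<in> {3*x, -1, -2-2*x, 1}" if "expr_size f = 3" for f 
  proof -
    have "x+x+x = 3*x" "x+x*x = -1" "x*(x+x) = -2-2*x" using x2 by (simp_all only: distrib_left) simp_all
    thus ?thesis using expr_size_3[OF that, of x] x3 by auto
  qed
  have e0: "expr_eval x e = 0" using e x_def by simp
  have sq: "sqrt 3 > 0" by simp
  from c show False
  proof (elim disjE)
    assume "expr_size e = 4"
    then obtain a b where *: "e = Add a b \<or> e = Mul a b"
      "expr_size a + expr_size b = 4" "expr_size a \<ge> 1" "expr_size b \<ge> 1" using expr_size_split[of e] by auto
    hence "(expr_size a = 1 \<and> expr_size b = 3) \<or> (expr_size a = 3 \<and> expr_size b = 1) \<or> (expr_size a = 2 \<and> expr_size b = 2)" by auto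
    hence "(expr_eval x a = x \<and> expr_eval x b \<in> {3*x, -1, -2-2*x, 1}) \<or> (expr_eval x b = x \<and> expr_eval x a \<in> {3*x, -1, -2-2*x, 1})
      \<or> (expr_eval x a \<in> {2*x, -1-x} \<and> expr_eval x b \<in> {2*x, -1-x})" using expr_size_1 y2 y3 by (metis expr_eval.simps(1))
    note v = this
    have v0: "expr_eval x a \<noteq> 0" "expr_eval x b \<noteq> 0" using v nz by (auto simp: complex_eq_iff)
    from * have "e = Add a b" using e0 v0 by auto
    hence "expr_eval x a + expr_eval x b = 0" using e0 by simp
    thus False using v nz sq by (auto simp: complex_eq_iff)
  qed (use expr_size_1[of e] y2[of e] y3[of e] e0 nz in \<open>auto simp: complex_eq_iff\<close>)
qed


lemma complexity_0_geI: assumes "\<And>e. expr_eval (zeta k) e = 0 \<Longrightarrow> expr_size e \<ge> b" "expr_eval (zeta k) f = 0"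
  shows "complexity k 0 \<ge> b"
proof -
  have "\<exists>e. expr_size e = complexity k 0 \<and> expr_eval (zeta k) e = 0"
    unfolding complexity_def by (rule LeastI[of _ "expr_size f"]) (use assms(2) in auto)
  thus ?thesis using assms(1) by metis
qed

lemma complexity_2_0: "complexity 2 0 \<ge> 3"
  by (rule complexity_0_geI[where f="Add X (Mul X X)"]) (use zero_size_2 in \<open>simp_all add: zeta2\<close>)

lemma complexity_3_0: "complexity 3 0 \<ge> 5"
  by (rule complexity_0_geI[where f="Add X (Add (Mul X X) (Mul X (Mul X X)))"], erule zero_size_3)
    (simp add: zeta3 complex_eq_iff)

lemma zero_eq_sum_2: "0 = (\<Sum>i=1..2. of_nat 1 * zeta 2 ^ i)" 
proof -
  have "{1..2::nat} = {1,2}" by auto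
  thus ?thesis by (simp add: zeta2)
qed

lemma zero_eq_sum_3: "0 = (\<Sum>i=1..3. of_nat 1 * zeta 3 ^ i)" 
proof -
  have "{1..3::nat} = {1,2,3}" by auto
  thus ?thesis by (simp add: zeta3 complex_eq_iff power2_eq_square power3_eq_cube)
qed

lemma bound_fails_2: "\<not> real (complexity 2 0) \<le> (2 * real 2 - real 2 / real 2 + 1) * (log 2 \<bar>real 1\<bar> + 1) - 2"
  using complexity_2_0 by simp

lemma bound_fails_3: "\<not> real (complexity 3 0) \<le> (2 * real 3 - real 3 / real 3 + 1) * (log 2 \<bar>real 1\<bar> + 1) - 2"
  using complexity_3_0 by simp

end

theory Submission
  imports Defs
begin

text \<open>
  Write the coefficients in binary and apply Horner's rule to the digits. Doubling is done by
  the factor \<open>x + x\<close> of size \<open>2\<close>; the surplus factor \<open>x\<close> only rotates the coefficients of the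
  remaining quotient cyclically. Each digit is a sum of distinct powers of \<open>x\<close>, from which all
  complete cosets of the group of \<open>p\<close>-th roots of unity may be dropped, leaving at most \<open>k - k/p\<close> terms;
  Horner's rule in \<open>x\<close> evaluates it with size at most \<open>k - 1 + (k - k/p)\<close>. Digits that vanish are
  skipped, so only \<open>n = 0\<close> is left. It is the sum over a single coset if \<open>k\<close> is
  composite or some coefficient exceeds \<open>1\<close>, and for primes \<open>k \<ge> 5\<close> it is
  \<open>x + (x + x\<^sup>2) (x + x\<^sup>3 + \<dots> + x\<^bsup>k-2\<^esup>)\<close>.
\<close>

section \<open>Horner evaluation of sums of distinct powers\<close>

text \<open>Horner's rule factors \<open>x\<close> out of all exponents above 1. The at most
  \<open>N - 1\<close> multiplications cost one \<open>X\<close> each, and every exponent of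
  \<open>S\<close> contributes one more.\<close>

lemma ex_expr_sum_powers:
  fixes x :: "'a :: comm_semiring_1"
  assumes "S \<subseteq> {1..N}" "S \<noteq> {}"
  shows "\<exists>e. expr_size e + 1 \<le> N + card S \<and> expr_eval x e = (\<Sum>i\<in>S. x ^ i)"
  using assms
proof (induction N arbitrary: S)
  case 0
  then show ?case by auto
next
  case (Suc N)
  define T where "T = {i \<in> {1..N}. Suc i \<in> S}"
  have T: "T \<subseteq> {1..N}" "finite T" "finite (Suc ` T)" "1 \<notin> Suc ` T"
    by (auto simp: T_def)
  have S: "S = (if 1 \<in> S then insert 1 (Suc ` T) else Suc ` T)"
  proof -
    have "i \<in> Suc ` T" if "i \<in> S" "i \<noteq> 1" for i
      using that Suc.prems by (cases i) (auto simp: T_def)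
    moreover have "Suc ` T \<subseteq> S"
      by (auto simp: T_def)
    ultimately show ?thesis
      by auto
  qed
  have shift: "(\<Sum>i\<in>Suc ` T. x ^ i) = x * (\<Sum>i\<in>T. x ^ i)"
    by (simp add: sum.reindex sum_distrib_left)
  have cardT: "card (Suc ` T) = card T"
    by (simp add: card_image)
  show ?case
  proof (cases "T = {}")
    case True
    \<comment> \<open>The recursion ends here with a single \<open>X\<close>; going further would
      require an expression for the empty sum.\<close>
    then have "S = {1}"
      using S Suc.prems by (auto split: if_splits)
    then show ?thesis
      by (intro exI[of _ X]) simp
  next
    case False
    then obtain e where e: "expr_size e + 1 \<le> N + card T" "expr_eval x e = (\<Sum>i\<in>T. x ^ i)"
      using Suc.IH[OF T(1)] by blast
    show ?thesis
    proof (cases "1 \<in> S")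
      case True
      then have S': "S = insert 1 (Suc ` T)"
        using S by simp
      have "card S = Suc (card T)" "(\<Sum>i\<in>S. x ^ i) = x + x * (\<Sum>i\<in>T. x ^ i)"
        unfolding S' by (simp_all only: card_insert_disjoint[OF T(3,4)] sum.insert[OF T(3,4)] shift cardT power_one_right)
      then show ?thesis
        using e by (intro exI[of _ "Add X (Mul X e)"]) simp
    next
      case False
      then have S': "S = Suc ` T"
        using S by simp
      have "card S = card T" "(\<Sum>i\<in>S. x ^ i) = x * (\<Sum>i\<in>T. x ^ i)"
        unfolding S' by (simp_all only: cardT shift)
      then show ?thesis
        using e by (intro exI[of _ "Mul X e"]) simp
    qed
  qed
qed

section \<open>Roots of unity and cosets of exponents\<close>

lemma zeta_power_eq_1_iff:
  assumes "k > 0"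
  shows "zeta k ^ i = 1 \<longleftrightarrow> k dvd i"
proof -
  have "zeta k ^ i = cis (2 * pi * (real i / real k))"
    by (simp add: zeta_def cis_conv_exp exp_of_nat_mult[symmetric] field_simps)
  moreover have "cis (2 * pi * (real i / real k)) = 1 \<longleftrightarrow> (\<exists>j::int. real i / real k = j)"
  proof
    assume "cis (2 * pi * (real i / real k)) = 1"
    \<comment> \<open>Real parts suffice, as the cosine takes the value 1 only at integer multiples
      of \<open>2 * pi\<close>.\<close>
    then have "cos (2 * pi * (real i / real k)) = 1"
      by (simp add: complex_eq_iff)
    then have "\<exists>j::int. 2 * pi * (real i / real k) = of_int j * 2 * pi"
      by (simp only: cos_one_2pi_int)
    then obtain j :: int where "2 * pi * (real i / real k) = of_int j * 2 * pi"
      by blast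
    then have "(2 * pi) * (real i / real k) = (2 * pi) * of_int j"
      by (simp only: mult_ac)
    then have "real i / real k = j"
      by (subst (asm) mult_cancel_left) simp
    then show "\<exists>j::int. real i / real k = j" ..
  next
    assume "\<exists>j::int. real i / real k = j"
    then obtain j :: int where j: "real i / real k = j" ..
    show "cis (2 * pi * (real i / real k)) = 1"
      unfolding j by (rule cis_multiple_2pi) simp
  qed
  moreover have "(\<exists>j::int. real i / real k = j) \<longleftrightarrow> k dvd i"
  proof
    assume "\<exists>j::int. real i / real k = j"
    then obtain j :: int where "real i / real k = j"
      by blast
    then have "real_of_int (int i) = real_of_int (j * int k)"
      using assms by (simp add: field_simps)
    then have "int i = j * int k"
      by (simp only: of_int_eq_iff)
    then show "k dvd i"
      by (metis dvd_triv_right int_dvd_int_iff)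
  next
    assume "k dvd i"
    then obtain l where "i = k * l" ..
    then show "\<exists>j::int. real i / real k = j"
      using assms by (intro exI[of _ "int l"]) simp
  qed
  ultimately show ?thesis
    by simp
qed

text \<open>A geometric series in \<open>x ^ d\<close>: multiplied by \<open>1 - x ^ d\<close> it
  telescopes to \<open>1 - x ^ (d * p) = 0\<close>, and the nonzero factor cancels in a
  domain.\<close>

lemma sum_powers_coset_eq_0:
  fixes x :: "'a :: idom"
  assumes "x ^ (d * p) = 1" "x ^ d \<noteq> 1"
  shows "(\<Sum>j<p. x ^ (r + d * j)) = 0"
proof -
  have "(\<Sum>j<p. x ^ (r + d * j)) = x ^ r * (\<Sum>j<p. (x ^ d) ^ j)"
    by (simp add: sum_distrib_left power_add power_mult)
  moreover have "(1 - x ^ d) * (\<Sum>j<p. (x ^ d) ^ j) = 0"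
    using one_diff_power_eq[of "x ^ d" p] assms(1) by (simp add: power_mult)
  ultimately show ?thesis
    using assms(2) by simp
qed

text \<open>For \<open>k = d * p\<close> and \<open>x = zeta k\<close>, these are the exponents of
  \<open>x ^ r\<close> times the \<open>p\<close>-th roots of unity. Representatives
  \<open>r\<close> are taken from \<open>{1..d}\<close>, so that the cosets partition
  \<open>{1..k}\<close>.\<close>

definition coset :: "nat \<Rightarrow> nat \<Rightarrow> nat \<Rightarrow> nat set" where
  "coset d p r = (\<lambda>j. r + d * j) ` {..<p}"

lemma coset_disjoint:
  assumes "r \<in> {1..d}" "s \<in> {1..d}" "i \<in> coset d p r" "i \<in> coset d p s"
  shows "r = s"
proof -
  obtain j l where "i = r + d * j" "i = s + d * l"
    using assms(3,4) unfolding coset_def by blast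
  \<comment> \<open>Subtracting 1 turns the representatives \<open>1..d\<close> into the residues
    \<open>0..d - 1\<close> modulo \<open>d\<close>.\<close>
  then have "(r - 1) + d * j = (s - 1) + d * l"
    using assms(1,2) by auto
  then have "((r - 1) + d * j) mod d = ((s - 1) + d * l) mod d"
    by (rule arg_cong)
  then have "(r - 1) mod d = (s - 1) mod d"
    by (simp only: mod_mult_self2)
  moreover have "r - 1 < d" "s - 1 < d"
    using assms(1,2) by auto
  ultimately show ?thesis
    using assms(1,2) by auto
qed

lemma coset_subset:
  assumes "r \<in> {1..d}"
  shows "coset d p r \<subseteq> {1..d * p}"
proof
  fix i assume "i \<in> coset d p r"
  then obtain j where j: "j < p" "i = r + d * j"
    by (auto simp: coset_def)
  have "d * Suc j \<le> d * p"
    using j(1) by (intro mult_le_mono2) simp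
  then show "i \<in> {1..d * p}"
    using j(2) assms by auto
qed

lemma sum_over_coset:
  assumes "d > 0"
  shows "sum f (coset d p r) = (\<Sum>j<p. f (r + d * j))"
  unfolding coset_def using assms by (subst sum.reindex) (auto simp: inj_on_def)

text \<open>Dropping the cosets contained in \<open>S\<close> leaves the sum unchanged. Afterwards
  each of the \<open>d\<close> disjoint cosets misses an exponent, so at least \<open>d\<close> of
  the \<open>d * p\<close> exponents are absent from \<open>T\<close>.\<close>

lemma drop_complete_cosets:
  fixes x :: "'a :: idom"
  assumes x: "x ^ (d * p) = 1" "x ^ d \<noteq> 1" and p: "p > 0" and S: "S \<subseteq> {1..d * p}"
  obtains T where "T \<subseteq> S" "card T + d \<le> d * p" "(\<Sum>i\<in>T. x ^ i) = (\<Sum>i\<in>S. x ^ i)"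
proof -
  define R where "R = {r \<in> {1..d}. coset d p r \<subseteq> S}"
  define U where "U = (\<Union>r\<in>R. coset d p r)"
  define T where "T = S - U"
  have d: "d > 0"
    using x(2) by (auto intro: Nat.gr0I)
  have fin: "finite S"
    using S finite_subset by blast
  have "(\<Sum>i\<in>U. x ^ i) = (\<Sum>r\<in>R. \<Sum>i\<in>coset d p r. x ^ i)"
    unfolding U_def
  proof (rule sum.UNION_disjoint)
    show "\<forall>r\<in>R. \<forall>s\<in>R. r \<noteq> s \<longrightarrow> coset d p r \<inter> coset d p s = {}"
      using coset_disjoint by (fastforce simp: R_def)
  qed (auto simp: R_def coset_def)
  also have "\<dots> = 0"
    by (simp add: sum_over_coset[OF d] sum_powers_coset_eq_0[OF x])
  finally have U0: "(\<Sum>i\<in>U. x ^ i) = 0" .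
  have "U \<subseteq> S"
    by (auto simp: U_def R_def)
  then have sum_eq: "(\<Sum>i\<in>T. x ^ i) = (\<Sum>i\<in>S. x ^ i)"
    using U0 fin by (simp add: T_def sum_diff)
  \<comment> \<open>A dropped coset misses all its exponents, for instance \<open>r\<close>; any
    other coset already had one outside \<open>S\<close>.\<close>
  have "\<exists>i. i \<in> coset d p r \<and> i \<notin> T" if "r \<in> {1..d}" for r
  proof (cases "r \<in> R")
    case True
    moreover have "r \<in> coset d p r"
      using p by (force simp: coset_def)
    ultimately show ?thesis
      by (auto simp: T_def U_def)
  next
    case False
    then show ?thesis
      using that by (auto simp: R_def T_def)
  qed
  then obtain f where f: "\<And>r. r \<in> {1..d} \<Longrightarrow> f r \<in> coset d p r \<and> f r \<notin> T"
    by metis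
  have "inj_on f {1..d}"
    using f coset_disjoint by (metis inj_onI)
  then have "card (f ` {1..d}) = d"
    by (simp add: card_image)
  moreover have "f ` {1..d} \<subseteq> {1..d * p} - T"
    using f coset_subset by blast
  then have "card (f ` {1..d}) \<le> card ({1..d * p} - T)"
    by (rule card_mono[rotated]) simp
  moreover have "card ({1..d * p} - T) + card T = d * p"
  proof -
    have "T \<subseteq> {1..d * p}"
      using S by (auto simp: T_def)
    then have "card ({1..d * p} - T) = d * p - card T" "card T \<le> d * p"
      using card_Diff_subset[of T "{1..d * p}"] card_mono[of "{1..d * p}" T] finite_subset[of T "{1..d * p}"]
      by auto
    then show ?thesis
      by simp
  qed
  ultimately show ?thesis
    using that[of T] sum_eq by (auto simp: T_def)
qed

section \<open>Induction on the number of binary digits\<close>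

text \<open>Size \<open>k - 1 + (k - d)\<close> per binary digit, and \<open>2\<close> for each doubling \<open>x + x\<close>.\<close>

lemma ex_expr_sum_bounded:
  fixes x :: complex
  assumes k: "k = d * p" "k > 0" and x: "x ^ k = 1" "x ^ d \<noteq> 1"
    and a: "\<And>i. i \<in> {1..k} \<Longrightarrow> a i < 2 ^ Suc L"
    and nz: "(\<Sum>i=1..k. of_nat (a i) * x ^ i) \<noteq> 0"
  shows "\<exists>e. expr_size e + 2 \<le> (2 * k - d + 1) * Suc L
           \<and> expr_eval x e = (\<Sum>i=1..k. of_nat (a i) * x ^ i)"
proof -
  have p: "p > 0" and dk: "d \<le> k"
    using k by (auto intro: Nat.gr0I)
  have digit: "\<exists>e. expr_size e + 1 + d \<le> 2 * k \<and> expr_eval x e = (\<Sum>i=1..k. of_nat (b i) * x ^ i)"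
    if b: "\<And>i. i \<in> {1..k} \<Longrightarrow> b i < 2" and nz: "(\<Sum>i=1..k. of_nat (b i) * x ^ i) \<noteq> 0" for b :: "nat \<Rightarrow> nat"
  proof -
    define S where "S = {i \<in> {1..k}. b i = 1}"
    have "of_nat (b i) * x ^ i = (if b i = 1 then x ^ i else 0)" if "i \<in> {1..k}" for i
      using b[OF that] by (auto simp: less_2_cases_iff)
    then have "(\<Sum>i=1..k. of_nat (b i) * x ^ i) = (\<Sum>i=1..k. if b i = 1 then x ^ i else 0)"
      by (rule sum.cong[OF refl])
    also have "\<dots> = (\<Sum>i\<in>S. x ^ i)"
      unfolding S_def by (rule sum.inter_filter[symmetric]) simp
    finally have S: "(\<Sum>i=1..k. of_nat (b i) * x ^ i) = (\<Sum>i\<in>S. x ^ i)" .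
    obtain T where T: "T \<subseteq> S" "card T + d \<le> k" "(\<Sum>i\<in>T. x ^ i) = (\<Sum>i\<in>S. x ^ i)"
    proof (rule drop_complete_cosets)
      show "x ^ (d * p) = 1" "x ^ d \<noteq> 1" "p > 0"
        using x p by (simp_all add: k(1))
      show "S \<subseteq> {1..d * p}"
        unfolding S_def k(1)[symmetric] by blast
    qed (unfold k(1), blast)
    have "T \<noteq> {}"
      using T(3) nz S by auto
    moreover have "T \<subseteq> {1..k}"
      using T(1) by (auto simp: S_def)
    ultimately obtain e where "expr_size e + 1 \<le> k + card T" "expr_eval x e = (\<Sum>i\<in>T. x ^ i)"
      using ex_expr_sum_powers by blast
    then show ?thesis
      using T(2,3) S by (intro exI[of _ e]) auto
  qed
  show ?thesis
    using a nz
  proof (induction L arbitrary: a)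
    case 0
    obtain e where "expr_size e + 1 + d \<le> 2 * k" "expr_eval x e = (\<Sum>i=1..k. of_nat (a i) * x ^ i)"
      using digit[of a] 0 by auto
    then show ?case
      using dk by (intro exI[of _ e]) auto
  next
    case (Suc L)
    \<comment> \<open>\<open>b\<close> holds the last binary digits. \<open>c\<close> holds the
      halved coefficients shifted down by one exponent, which absorbs the extra \<open>x\<close> in
      \<open>(x + x) * C = 2 * (x * C)\<close>; the entry at \<open>k\<close> wraps around to
      exponent 1 because \<open>x ^ Suc k = x\<close>.\<close>
    define b c where "b = (\<lambda>i. a i mod 2)" and "c = (\<lambda>i. if i = k then a 1 div 2 else a (Suc i) div 2)"
    define B C where "B = (\<Sum>i=1..k. of_nat (b i) * x ^ i)" and "C = (\<Sum>i=1..k. of_nat (c i) * x ^ i)"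
    have xC: "x * C = (\<Sum>i=1..k. of_nat (a i div 2) * x ^ i)"
    proof -
      obtain k' where k': "k = Suc k'"
        using k(2) by (cases k) auto
      have "x * C = (\<Sum>i=1..k. of_nat (c i) * x ^ Suc i)"
        by (simp add: C_def sum_distrib_left mult_ac)
      also have "\<dots> = (\<Sum>i=1..k'. of_nat (a (Suc i) div 2) * x ^ Suc i) + of_nat (a 1 div 2) * x"
        using x(1) by (simp add: k' c_def)
      also have "(\<Sum>i=1..k'. of_nat (a (Suc i) div 2) * x ^ Suc i) = (\<Sum>i=Suc 1..Suc k'. of_nat (a i div 2) * x ^ i)"
        by (simp only: sum.shift_bounds_cl_Suc_ivl)
      also have "\<dots> + of_nat (a 1 div 2) * x = (\<Sum>i=1..k. of_nat (a i div 2) * x ^ i)"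
        unfolding k' by (subst (2) sum.atLeast_Suc_atMost) simp_all
      finally show ?thesis .
    qed
    have split: "(\<Sum>i=1..k. of_nat (a i) * x ^ i) = B + (x + x) * C"
    proof -
      have "of_nat (a i) * x ^ i = of_nat (b i) * x ^ i + 2 * (of_nat (a i div 2) * x ^ i)" for i
      proof -
        have "(of_nat (a i) :: complex) = of_nat (b i + 2 * (a i div 2))"
          by (simp add: b_def)
        then show ?thesis
          by (simp only: of_nat_add of_nat_mult of_nat_numeral algebra_simps)
      qed
      then have "(\<Sum>i=1..k. of_nat (a i) * x ^ i) = B + 2 * (x * C)"
        by (simp add: B_def xC sum.distrib sum_distrib_left)
      then show ?thesis
        by (simp add: algebra_simps)
    qed
    have c_less: "c i < 2 ^ Suc L" if "i \<in> {1..k}" for i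
      using that Suc.prems(1)[of 1] Suc.prems(1)[of "Suc i"] by (auto simp: c_def)
    have "\<exists>e. expr_size e + 1 + d \<le> 2 * k \<and> expr_eval x e = B" if "B \<noteq> 0"
      using digit[of b] that by (simp add: b_def B_def)
    moreover have "\<exists>e. expr_size e + 2 \<le> (2 * k - d + 1) * Suc L \<and> expr_eval x e = C" if "C \<noteq> 0"
      using Suc.IH[of c] c_less that by (simp add: C_def)
    \<comment> \<open>The increment is exactly \<open>(2 * k - d - 1) + 2\<close>: the digit
      \<open>B\<close> and the factor \<open>x + x\<close>.\<close>
    moreover have step: "(2 * k - d + 1) * Suc (Suc L) = (2 * k - d + 1) * Suc L + (2 * k - d + 1)"
      by simp
    \<comment> \<open>Small expressions are available only for nonzero \<open>B\<close> and
      \<open>C\<close>, so a vanishing one is left out of the sum.\<close>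
    moreover have "B \<noteq> 0 \<or> C \<noteq> 0"
      using Suc.prems(2) split by auto
    ultimately consider
        (BC) e f where "expr_size e + 1 + d \<le> 2 * k" "expr_eval x e = B"
          "expr_size f + 2 \<le> (2 * k - d + 1) * Suc L" "expr_eval x f = C"
      | (B) e where "expr_size e + 1 + d \<le> 2 * k" "expr_eval x e = B" "C = 0"
      | (C) f where "B = 0" "expr_size f + 2 \<le> (2 * k - d + 1) * Suc L" "expr_eval x f = C"
      by metis
    then show ?case
    proof cases
      case BC
      then show ?thesis
        using dk unfolding split step
        by (intro exI[of _ "Add e (Mul (Add X X) f)"]) (simp del: mult_Suc_right)
    next
      case B
      then show ?thesis
        using dk unfolding split step by (intro exI[of _ e]) (simp del: mult_Suc_right)
    next
      case C
      then show ?thesis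
        using dk k(2) unfolding split step
        by (intro exI[of _ "Mul (Add X X) f"]) (simp del: mult_Suc_right)
    qed
  qed
qed

section \<open>Short expressions for zero\<close>

text \<open>Horner's rule for the coset \<open>{d, 2 * d, ..., k}\<close>, whose sum vanishes and
  has at most \<open>p\<close> terms.\<close>

lemma ex_expr_0_coset:
  fixes x :: "'a :: idom"
  assumes k: "k = d * p" "k > 0" and x: "x ^ k = 1" "x ^ d \<noteq> 1"
  shows "\<exists>e. expr_size e + 1 \<le> k + p \<and> expr_eval x e = 0"
proof -
  have dp: "d > 0" "p > 0"
    using k by (auto intro: Nat.gr0I)
  have "(\<Sum>i\<in>coset d p d. x ^ i) = 0"
    using sum_over_coset[OF dp(1), of "\<lambda>i. x ^ i"] sum_powers_coset_eq_0[of x d p d] x k(1) by simp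
  moreover have "coset d p d \<subseteq> {1..k}" "coset d p d \<noteq> {}"
    using coset_subset[of d d p] dp k(1) by (auto simp: coset_def)
  moreover have "card (coset d p d) \<le> p"
    unfolding coset_def using card_image_le[of "{..<p}"] by simp
  ultimately show ?thesis
    using ex_expr_sum_powers[of "coset d p d" k x] by fastforce
qed

text \<open>Pairing neighbouring exponents into the common factor \<open>x + x * x\<close> gives
  size at most \<open>3 * m + 2\<close> for \<open>k = 2 * m + 1\<close>; the bound
  \<open>3 * m + 4 \<le> 2 * k\<close> amounts to \<open>m \<ge> 2\<close>, that is
  \<open>k \<ge> 5\<close>.\<close>

lemma ex_expr_0_odd:
  fixes x :: "'a :: idom"
  assumes k: "odd k" "k \<ge> 5" and x: "x ^ k = 1" "x \<noteq> 1"
  shows "\<exists>e. expr_size e + 2 \<le> 2 * k \<and> expr_eval x e = 0"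
proof -
  obtain m where m: "k = 2 * m + 1" "m \<ge> 2"
    using k by (auto elim!: oddE)
  define S where "S = (\<lambda>j. 2 * j + 1) ` {..<m}"
  have "S \<subseteq> {1..2 * m - 1}" "S \<noteq> {}" "card S = m"
    using m(2) by (auto simp: S_def card_image inj_on_def lessThan_empty_iff)
  then obtain e where e: "expr_size e + 1 \<le> 2 * m - 1 + m" "expr_eval x e = (\<Sum>i\<in>S. x ^ i)"
    using ex_expr_sum_powers by metis
  \<comment> \<open>The product has the terms \<open>x ^ (2 * j + 2)\<close> and
    \<open>x ^ (2 * j + 3)\<close>, so each exponent from 2 to \<open>2 * n + 1\<close> occurs once
    and the leading \<open>x\<close> completes them.\<close>
  have "x + (x + x * x) * (\<Sum>j<n. x ^ (2 * j + 1)) = x * (\<Sum>i<2 * n + 1. x ^ i)" for n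
    by (induction n) (simp_all add: algebra_simps)
  moreover have "(\<Sum>i<k. x ^ i) = 0"
    using one_diff_power_eq[of x k] x by simp
  moreover have "(\<Sum>i\<in>S. x ^ i) = (\<Sum>j<m. x ^ (2 * j + 1))"
    by (simp add: S_def sum.reindex inj_on_def)
  ultimately have "expr_eval x (Add X (Mul (Add X (Mul X X)) e)) = 0"
    using e(2) m(1) by simp
  moreover have "expr_size (Add X (Mul (Add X (Mul X X)) e)) + 2 \<le> 2 * k"
    using e(1) m by simp
  ultimately show ?thesis
    by blast
qed

text \<open>For these \<open>k\<close> the only linear relations among the powers of
  \<open>zeta k\<close> are multiples of their total sum, so \<open>a\<close> is constant.\<close>

lemma sum_zeta_eq_0_imp_all_1:
  assumes "k \<in> {2, 3}" "\<And>i. i \<in> {1..k} \<Longrightarrow> a i \<le> Suc 0" "\<exists>i\<in>{1..k}. a i \<noteq> 0"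
    and "(\<Sum>i=1..k. of_nat (a i) * zeta k ^ i) = 0"
  shows "\<forall>i\<in>{1..k}. a i = 1"
proof -
  have sets: "{1..2::nat} = {1, 2}" "{1..3::nat} = {1, 2, 3}"
    by auto
  consider "k = 2" | "k = 3"
    using assms(1) by auto
  then show ?thesis
  proof cases
    case 1
    then have "a 1 = a 2"
      using assms(4) unfolding 1 sets by (simp add: zeta2 complex_eq_iff)
    moreover have "a 1 \<le> 1"
      using assms(2)[of 1] 1 by simp
    moreover have "a 1 \<noteq> 0 \<or> a 2 \<noteq> 0"
      using assms(3) unfolding 1 sets by blast
    ultimately show ?thesis
      unfolding 1 sets by simp
  next
    case 2
    have "a 1 = a 2 \<and> a 2 = a 3"
      using assms(4) unfolding 2 sets
      by (simp add: zeta3 complex_eq_iff power2_eq_square power3_eq_cube)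
    moreover have "a 1 \<le> 1"
      using assms(2)[of 1] 2 by simp
    moreover have "a 1 \<noteq> 0 \<or> a 2 \<noteq> 0 \<or> a 3 \<noteq> 0"
      using assms(3) unfolding 2 sets by blast
    ultimately show ?thesis
      unfolding 2 sets by simp
  qed
qed

section \<open>From expressions to the complexity bound\<close>

lemma complexity_le: "expr_eval (zeta k) e = \<alpha> \<Longrightarrow> complexity k \<alpha> \<le> expr_size e"
  unfolding complexity_def by (rule Least_le) auto

theorem theorem2p6:
  fixes k p m :: nat and a :: "nat \<Rightarrow> nat" and n :: complex
  assumes "k \<ge> 2"
    and "p = Min {q. prime q \<and> q dvd k}"
    and "n \<in> cyclotomic_ints k"
    and "n = (\<Sum>i=1..k. of_nat (a i) * zeta k ^ i)"
    and "\<exists>i\<in>{1..k}. a i \<noteq> 0"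
    and "m \<in> {1..k}" and "a m = Max (a ` {1..k})"
    and "\<not> (k \<in> {2, 3} \<and> (\<forall>i\<in>{1..k}. a i = 1))"
  shows "real (complexity k n)
    \<le> (2 * real k - real k / real p + 1) * (log 2 \<bar>real (a m)\<bar> + 1) - 2"
proof -
  have "finite {q. prime q \<and> q dvd k}"
    using assms(1) finite_divisors_nat[of k] by (auto intro: rev_finite_subset)
  moreover have "{q. prime q \<and> q dvd k} \<noteq> {}"
    using assms(1) prime_factor_nat[of k] by auto
  ultimately have p: "prime p" "p dvd k"
    using Min_in[of "{q. prime q \<and> q dvd k}"] assms(2) by auto
  then obtain d where d: "k = d * p"
    by (metis dvdE mult.commute)
  have p2: "p \<ge> 2"
    using p(1) prime_ge_2_nat by blast
  have d0: "d > 0" and k0: "k > 0"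
    using assms(1) d by (auto intro: Nat.gr0I)
  have dk: "d < k"
    using d d0 p2 by simp
  have x: "zeta k ^ k = 1" "zeta k ^ d \<noteq> 1"
    using zeta_power_eq_1_iff[OF k0] dk d0 by (auto dest: dvd_imp_le)
  have a_le: "a i \<le> a m" if "i \<in> {1..k}" for i
    using that assms(7) by simp
  have am: "a m \<ge> 1"
    using assms(5) a_le by (metis le_zero_eq less_one not_le)
  \<comment> \<open>\<open>Suc L\<close> is the number of binary digits of \<open>a m\<close>, hence
    at most \<open>log 2 (a m) + 1\<close>.\<close>
  obtain L where L: "2 ^ L \<le> a m" "a m < 2 ^ Suc L"
    using ex_power_ivl1[of 2 "a m"] am by auto
  have bound: ?thesis
    if "expr_eval (zeta k) e = n" "expr_size e + 2 \<le> (2 * k - d + 1) * Suc L" for e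
  proof -
    have "real L \<le> log 2 (real (a m))"
      using L(1) am by (simp add: le_log_iff powr_realpow)
    then have "real ((2 * k - d + 1) * Suc L) \<le> real (2 * k - d + 1) * (log 2 (real (a m)) + 1)"
      unfolding of_nat_mult by (intro mult_left_mono) auto
    also have "real (2 * k - d + 1) = 2 * real k - real k / real p + 1"
      using dk p2 d by (simp add: of_nat_diff)
    finally have "real ((2 * k - d + 1) * Suc L) \<le> (2 * real k - real k / real p + 1) * (log 2 (real (a m)) + 1)" .
    moreover have "real (complexity k n) + 2 \<le> real ((2 * k - d + 1) * Suc L)"
      using complexity_le[OF that(1)] that(2) by linarith
    ultimately have "real (complexity k n) + 2 \<le> (2 * real k - real k / real p + 1) * (log 2 (real (a m)) + 1)"
      by linarith
    then show ?thesis
      by (simp only: abs_of_nat le_diff_eq)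
  qed
  show ?thesis
  proof (cases "n = 0")
    case False
    then show ?thesis
      using ex_expr_sum_bounded[OF d k0 x, of a L] a_le L(2) assms(4) bound
      by (meson le_less_trans)
  next
    case n0: True
    have one: "2 * k - d + 1 \<le> (2 * k - d + 1) * Suc L"
      by simp
    obtain e where e: "expr_size e + 1 \<le> k + p" "expr_eval (zeta k) e = 0"
      using ex_expr_0_coset[OF d k0 x] by blast
    \<comment> \<open>The coset expression gives \<open>expr_size e + 2 \<le> k + p + 1\<close>,
      which fits into \<open>(2 * k - d + 1) * Suc L\<close> if \<open>k\<close> is composite or
      \<open>L \<ge> 1\<close>. For \<open>d = 1\<close> and \<open>L = 0\<close> this estimate
      exceeds the budget \<open>2 * k\<close> by 1.\<close>
    consider "d \<ge> 2" | "d = 1" "L \<ge> 1" | "d = 1" "L = 0"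
      using d0 by linarith
    then show ?thesis
    proof cases
      case 1
      \<comment> \<open>This encodes \<open>(d - 1) * (p - 1) \<ge> 1\<close>, that is
        \<open>p + d \<le> d * p\<close>.\<close>
      then obtain u v where "d = u + 2" "p = v + 2"
        using p2 by (metis add.commute le_Suc_ex)
      then have "p + d \<le> k"
        using d by (simp add: algebra_simps)
      then show ?thesis
        using bound[of e] e n0 one dk by fastforce
    next
      case 2
      have "(2 * k - d + 1) * 2 \<le> (2 * k - d + 1) * Suc L"
        using 2(2) by (intro mult_le_mono2) simp
      then show ?thesis
        using bound[of e] e n0 d 2(1) by simp
    next
      case 3
      \<comment> \<open>Here \<open>L = 0\<close> bounds all coefficients by 1, so
        \<open>k = 2\<close> or \<open>k = 3\<close> would force the excluded all-ones case.\<close>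
      have "k \<notin> {2, 3}"
        using sum_zeta_eq_0_imp_all_1[of k a] assms(4,5,8) n0 a_le L(2) 3(2)
        by (metis One_nat_def less_2_cases_iff le_less_trans less_Suc_eq_le numeral_2_eq_2 power_one_right)
      moreover have "prime k"
        using p(1) d 3(1) by simp
      ultimately have "odd k" "k \<ge> 5"
      proof -
        show "odd k"
          using \<open>prime k\<close> \<open>k \<notin> {2, 3}\<close> primes_dvd_imp_eq two_is_prime_nat by blast
        then show "k \<ge> 5"
          using \<open>k \<notin> {2, 3}\<close> assms(1) by (cases "k = 4") auto
      qed
      then show ?thesis
        using ex_expr_0_odd[of k "zeta k"] x 3 n0 bound by fastforce
    qed
  qed
qed

end
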